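(* Let $n\ge 1$ be an integer. If Alice and Bob, with inputs $\vec a\in\mathbb{S}_n$ and $\vec b\in\mathbb{S}_n$ respectively, share a random variable $\vec\lambda_s\in\mathbb{S}_n$ distributed according to the biased distribution with probability density $$\rho(\vec\lambda_s\mid\vec a\vec b)=\rho_{\vec a}(\vec\lambda_s)=\frac{|\vec a\cdot\vec\lambda_s|}{R_n},$$ then, without any further resource, they can simulate the joint correlations $E(AB\mid\vec a\vec b)=\vec a\cdot\vec b$ with marginal expectations $E(A\mid\vec a\vec b)=E(B\mid\vec a\vec b)=0$. That is, there exist measurable output functions $A,B:\mathbb{S}_n\times\mathbb{S}_n\to\{1,-1\}$ such that for all $\vec a,\vec b\in\mathbb{S}_n$, $$\int_{\mathbb{S}_n}\rho_{\vec a}(\vec\lambda_s)\,A(\vec a,\vec\lambda_s)\,B(\vec b,\vec\lambda_s)\,d\vec\lambda_s=\vec a\cdot\vec b,$$ $$\int_{\mathbb{S}_n}\rho_{\vec a}(\vec\lambda_s)\,A(\vec a,\vec\lambda_s)\,d\vec\lambda_s=0,\qquad \int_{\mathbb{S}_n}\rho_{\vec a}(\vec\lambda_s)\,B(\vec b,\vec\lambda_s)\,d\vec\lambda_s=0.$$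
   Context: $\mathbb{S}_n$ is the unit sphere in $\mathbb{R}^{n+1}$, $d\vec\lambda_s$ is the (unnormalized) surface measure on $\mathbb{S}_n$, with respect to which densities are taken, and $\vec x\cdot\vec y$ is the Euclidean inner product. $\mathcal{S}_{m}=2\pi^{(m+1)/2}/\Gamma((m+1)/2)$ denotes the surface area of $\mathbb{S}_m$ (so $\mathcal{S}_0=2$), and $R_n=\frac{2}{n}\mathcal{S}_{n-1}$. Simulation in this model: Alice's output $A\in\{1,-1\}$ depends only on her input $\vec a$ and the shared variable $\vec\lambda_s$; Bob's output $B\in\{1,-1\}$ depends only on his input $\vec b$ and $\vec\lambda_s$; the expectations $E(\cdot\mid\vec a\vec b)$ are over $\vec\lambda_s$ drawn from the density $\rho_{\vec a}$. *)

theory Defs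
  imports "HOL-Analysis.Analysis"
begin

definition sphere_borel :: "'a::euclidean_space measure" where
  "sphere_borel = restrict_space borel (sphere 0 1)"

text \<open>
  The surface measure of the unit sphere of a \<open>d\<close>-dimensional Euclidean space, via cones:
  \<open>\<sigma> E = d * vol {t x | x \<in> E, 0 < t \<le> 1}\<close>. Note that \<open>sgn x = x /\<^sub>R norm x\<close>.
\<close>

definition surface_measure :: "'a::euclidean_space measure" where
  "surface_measure = scale_measure (of_nat DIM('a))
     (distr (restrict_space lborel (cball 0 1 - {0})) sphere_borel sgn)"

text \<open>The area of the unit sphere of dimension \<open>m\<close>, which lies in dimension \<open>m + 1\<close>.\<close>

definition sphere_area :: "nat \<Rightarrow> real" where
  "sphere_area m = 2 * pi powr ((real m + 1) / 2) / Gamma ((real m + 1) / 2)"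

definition bias_norm :: "nat \<Rightarrow> real" where
  "bias_norm n = 2 / real n * sphere_area (n - 1)"

definition biased_density :: "nat \<Rightarrow> 'a::euclidean_space \<Rightarrow> 'a \<Rightarrow> real" where
  "biased_density n a l = \<bar>a \<bullet> l\<bar> / bias_norm n"

lemma space_sphere_borel: "space sphere_borel = sphere 0 1"
  by (simp add: sphere_borel_def space_restrict_space)

lemma space_surface_measure: "space surface_measure = sphere 0 1"
  by (simp add: surface_measure_def space_scale_measure space_sphere_borel)

lemma sets_surface_measure: "sets surface_measure = sets sphere_borel"
  by (simp add: surface_measure_def)

lemma measurable_sgn_sphere_borel:
  "sgn \<in> measurable (restrict_space lborel (cball 0 1 - {0 :: 'a::euclidean_space})) sphere_borel"
  unfolding sphere_borel_def
proof (rule measurable_restrict_space2)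
  show "sgn \<in> space (restrict_space lborel (cball 0 1 - {0 :: 'a})) \<rightarrow> sphere 0 1"
    by (auto simp: space_restrict_space norm_sgn)
  have "(\<lambda>x :: 'a. x /\<^sub>R norm x) \<in> borel_measurable borel"
    by measurable
  hence "sgn \<in> borel_measurable (borel :: 'a measure)"
    by (simp add: sgn_div_norm[abs_def])
  thus "sgn \<in> borel_measurable (restrict_space lborel (cball 0 1 - {0 :: 'a}))"
    by (intro measurable_restrict_space1) simp
qed

lemma emeasure_surface_measure:
  assumes "E \<in> sets (sphere_borel :: 'a::euclidean_space measure)"
  shows "emeasure surface_measure E =
    of_nat DIM('a) * emeasure lborel {x. x \<noteq> 0 \<and> norm x \<le> 1 \<and> sgn x \<in> E}"
proof -
  have "sgn -` E \<inter> (cball 0 1 - {0}) = {x. x \<noteq> 0 \<and> norm x \<le> 1 \<and> sgn x \<in> E}"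
    by auto
  moreover have "emeasure (distr (restrict_space lborel (cball 0 1 - {0 :: 'a})) sphere_borel sgn) E
      = emeasure lborel (sgn -` E \<inter> (cball 0 1 - {0}))"
    by (simp add: emeasure_distr[OF measurable_sgn_sphere_borel assms] space_restrict_space
        emeasure_restrict_space)
  ultimately show ?thesis
    by (simp add: surface_measure_def)
qed

lemma emeasure_surface_measure_sphere:
  "emeasure (surface_measure :: 'a::euclidean_space measure) (sphere 0 1)
     = ennreal (sphere_area (DIM('a) - 1))"
proof -
  have pos: "0 < real DIM('a)" by simp
  have "sphere 0 1 \<in> sets (sphere_borel :: 'a measure)"
    by (metis sets.top space_sphere_borel)
  moreover have "{x :: 'a. x \<noteq> 0 \<and> norm x \<le> 1 \<and> sgn x \<in> sphere 0 1} = cball 0 1 - {0}"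
    by (auto simp: norm_sgn)
  moreover have "emeasure lborel (cball 0 1 - {0 :: 'a}) = emeasure lborel (cball 0 1 :: 'a set)"
    by (rule emeasure_Diff_null_set) (auto simp: null_sets_def)
  ultimately have "emeasure (surface_measure :: 'a measure) (sphere 0 1)
      = of_nat DIM('a) * ennreal (unit_ball_vol (real DIM('a)))"
    by (simp add: emeasure_surface_measure emeasure_cball)
  also have "\<dots> = ennreal (real DIM('a) * unit_ball_vol (real DIM('a)))"
    by (simp add: ennreal_mult ennreal_of_nat_eq_real_of_nat)
  also have "real DIM('a) * unit_ball_vol (real DIM('a)) = sphere_area (DIM('a) - 1)"
  proof -
    have "real DIM('a) / 2 \<notin> \<int>\<^sub>\<le>\<^sub>0"
      using pos nonpos_Ints_nonpos[of "real DIM('a) / 2"] by linarith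
    hence "Gamma (real DIM('a) / 2 + 1) = real DIM('a) / 2 * Gamma (real DIM('a) / 2)"
      by (rule Gamma_plus1)
    moreover have "real (DIM('a) - 1) + 1 = real DIM('a)"
      by (simp add: of_nat_diff)
    moreover have "Gamma (real DIM('a) / 2) > 0"
      using pos by (intro Gamma_real_pos) simp
    ultimately show ?thesis
      using pos unfolding unit_ball_vol_def sphere_area_def by (simp only:) (simp add: divide_simps)
  qed
  finally show ?thesis .
qed

end

theory Submission
  imports Defs
begin

text \<open>
  Both parties output the sign of their inner product with \<open>l\<close>. The weight \<open>\<bar>a \<bullet> l\<bar>\<close> times Alice's
  sign is \<open>a \<bullet> l\<close>, so the correlation is a multiple of \<open>\<integral> (a \<bullet> l) sign (b \<bullet> l)\<close>, which is linear in
  \<open>a\<close>. It vanishes for \<open>a\<close> orthogonal to \<open>b\<close>, by reflection along \<open>a\<close>, and for \<open>a = b\<close> it is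
  \<open>\<integral> \<bar>b \<bullet> l\<bar>\<close>, twice the volume of the equatorial unit ball. The marginals vanish by symmetry.
\<close>

subsection \<open>Orthogonal invariance of the Lebesgue and surface measures\<close>

lemma measurable_orthogonal_transformation:
  fixes f :: "'a::euclidean_space \<Rightarrow> 'a"
  assumes "orthogonal_transformation f"
  shows "f \<in> borel_measurable borel"
proof (rule borel_measurable_continuous_onI)
  have "bounded_linear f"
    using assms linear_conv_bounded_linear orthogonal_transformation_linear by blast
  then show "continuous_on UNIV f"
    by (rule linear_continuous_on)
qed

text \<open>The determinant formula of the library is restricted to well-ordered index types. Instead, by
  Vitali's covering theorem, an open set is up to a null set a disjoint union of balls, and these
  are mapped to balls of the same radius.\<close>

lemma emeasure_lborel_vimage_orthogonal_transformation:
  fixes f :: "'a::euclidean_space \<Rightarrow> 'a"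
  assumes f: "orthogonal_transformation f" and S: "open S"
  shows "emeasure lborel (f -` S) = emeasure lborel S"
proof -
  define g where "g = inv f"
  define K where "K = {(x, r). 0 < r \<and> ball x r \<subseteq> S}"
  have bij: "bij f"
    by (rule orthogonal_transformation_bij[OF f])
  have fg: "f (g y) = y" and gf: "g (f y) = y" for y
    using bij by (auto simp: g_def bij_def surj_f_inv_f)
  have vimage_eq: "f -` X = g ` X" for X
    using fg gf by (metis bij bij_vimage_eq_inv_image g_def)
  have g_linear: "linear g"
    using f by (simp add: g_def orthogonal_transformation_inv orthogonal_transformation_linear)
  note f_meas = measurable_orthogonal_transformation[OF f]
  have ball_vimage: "f -` ball x r = ball (g x) r" for x r
  proof -
    have "norm (x - f y) = norm (g x - y)" for y
      using orthogonal_transformation_norm[OF f, of "g x - y"]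
      by (simp add: linear_diff[OF orthogonal_transformation_linear[OF f]] fg)
    then show ?thesis
      by (auto simp: dist_norm)
  qed
  obtain C where C: "countable C" "C \<subseteq> K"
      "pairwise (\<lambda>i j. disjnt (ball (fst i) (snd i)) (ball (fst j) (snd j))) C"
      "negligible (S - (\<Union>i\<in>C. ball (fst i) (snd i)))"
  proof (rule Vitali_covering_theorem_balls[of S K fst snd])
    fix x :: 'a and d :: real
    assume "x \<in> S" "0 < d"
    then obtain e where "0 < e" "ball x e \<subseteq> S"
      using S by (meson openE)
    then show "\<exists>i. i \<in> K \<and> x \<in> ball (fst i) (snd i) \<and> snd i < d"
      \<comment> \<open>The witness is centred at \<open>x\<close> itself: radius at most
        \<open>e\<close> keeps it inside \<open>S\<close>, and \<open>d / 2\<close> meets the strict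
        bound.\<close>
      using \<open>0 < d\<close> by (intro exI[of _ "(x, min e (d / 2))"]) (auto simp: K_def)
  qed
  define B where "B i = ball (fst i) (snd i)" for i :: "'a \<times> real"
  define U where "U = (\<Union>i\<in>C. B i)"
  have B_sets: "B i \<in> sets borel" for i
    by (simp add: B_def)
  have U_open: "open U"
    by (auto simp: U_def B_def)
  have "B i \<subseteq> S" if "i \<in> C" for i
  proof -
    have "i \<in> K"
      using that C(2) by blast
    then show ?thesis
      by (cases i) (simp add: K_def B_def)
  qed
  then have US: "U \<subseteq> S"
    unfolding U_def by blast
  have disj: "disjoint_family_on B C"
    using C(3) unfolding disjoint_family_on_def pairwise_def disjnt_def B_def by blast
  have null: "emeasure lborel (S - U) = 0"
    using C(4) S U_open by (auto simp: U_def[symmetric] B_def[symmetric]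
        negligible_iff_null_sets null_sets_completion_iff)
  \<comment> \<open>The preimage under \<open>f\<close> is the image under the linear map
    \<open>g\<close>, and a differentiable map of the space to itself keeps null sets null.\<close>
  have "negligible (g ` (S - U))"
  proof (rule negligible_differentiable_image_negligible)
    show "negligible (S - U)"
      using C(4) by (simp add: U_def B_def)
    show "g differentiable_on S - U"
      using g_linear by (simp add: linear_imp_differentiable_on)
  qed simp
  moreover have D_sets: "f -` (S - U) \<in> sets borel"
    using S U_open by (intro measurable_sets_borel[OF f_meas]) auto
  ultimately have null': "emeasure lborel (f -` (S - U)) = 0"
    by (auto simp: vimage_eq negligible_iff_null_sets null_sets_completion_iff)
  have disj': "disjoint_family_on (\<lambda>i. f -` B i) C"
    using disj unfolding disjoint_family_on_def by blast
  have "emeasure lborel (f -` S) = emeasure lborel (f -` U \<union> f -` (S - U))"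
    using US by (intro arg_cong[where f="emeasure lborel"]) auto
  also have "\<dots> = emeasure lborel (f -` U)"
    using U_open D_sets null' measurable_sets_borel[OF f_meas, of U]
    by (intro emeasure_Un_null_set) (auto simp: null_sets_def)
  also have "f -` U = (\<Union>i\<in>C. f -` B i)"
    by (auto simp: U_def)
  also have "emeasure lborel \<dots> = (\<integral>\<^sup>+i. emeasure lborel (f -` B i) \<partial>count_space C)"
    using disj' C(1) B_sets measurable_sets_borel[OF f_meas]
    by (intro emeasure_UN_countable) auto
  also have "\<dots> = (\<integral>\<^sup>+i. emeasure lborel (B i) \<partial>count_space C)"
    using C(2) by (intro nn_integral_cong) (auto simp: B_def ball_vimage K_def emeasure_ball)
  also have "\<dots> = emeasure lborel U"
    unfolding U_def using disj C(1) B_sets by (intro emeasure_UN_countable[symmetric]) auto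
  also have "\<dots> = emeasure lborel (U \<union> (S - U))"
    using U_open S null by (intro emeasure_Un_null_set[symmetric]) (auto simp: null_sets_def)
  also have "U \<union> (S - U) = S"
    using US by auto
  finally show ?thesis .
qed

text \<open>Lebesgue measure is determined by its values on boxes, and boxes are open, so the open
  case suffices.\<close>

lemma distr_lborel_orthogonal_transformation:
  fixes f :: "'a::euclidean_space \<Rightarrow> 'a"
  assumes f: "orthogonal_transformation f"
  shows "distr lborel borel f = lborel"
proof (rule lborel_eqI[symmetric])
  fix l u :: 'a
  assume le: "\<And>b. b \<in> Basis \<Longrightarrow> l \<bullet> b \<le> u \<bullet> b"
  have "emeasure (distr lborel borel f) (box l u) = emeasure lborel (f -` box l u)"
    using measurable_orthogonal_transformation[OF f] by (subst emeasure_distr) auto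
  also have "\<dots> = emeasure lborel (box l u)"
    by (rule emeasure_lborel_vimage_orthogonal_transformation[OF f open_box])
  finally show "emeasure (distr lborel borel f) (box l u) = (\<Prod>b\<in>Basis. (u - l) \<bullet> b)"
    using le by (simp add: emeasure_lborel_box_eq)
qed simp

lemma measurable_orthogonal_transformation_sphere:
  fixes f :: "'a::euclidean_space \<Rightarrow> 'a"
  assumes "orthogonal_transformation f"
  shows "f \<in> sphere_borel \<rightarrow>\<^sub>M sphere_borel"
  unfolding sphere_borel_def
  using measurable_orthogonal_transformation[OF assms] orthogonal_transformation_norm[OF assms]
  by (intro measurable_restrict_space3) auto

text \<open>The surface measure of \<open>E\<close> is a multiple of the volume of the cone
  \<open>X\<close> over \<open>E\<close>. Since \<open>f\<close> preserves norms and commutes with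
  \<open>sgn\<close>, the cone over the preimage of \<open>E\<close> is the preimage of
  \<open>X\<close>, and Lebesgue invariance applies.\<close>

lemma distr_surface_measure_orthogonal_transformation:
  fixes f :: "'a::euclidean_space \<Rightarrow> 'a"
  assumes f: "orthogonal_transformation f"
  shows "distr surface_measure sphere_borel f = (surface_measure :: 'a measure)"
proof (rule measure_eqI)
  fix E :: "'a set"
  assume "E \<in> sets (distr surface_measure sphere_borel f)"
  then have E: "E \<in> sets sphere_borel"
    by simp
  note f_meas = measurable_orthogonal_transformation_sphere[OF f]
  have norm_f: "norm (f x) = norm x" for x
    by (rule orthogonal_transformation_norm[OF f])
  have f_sgn: "sgn (f x) = f (sgn x)" for x
    using f by (simp add: sgn_div_norm norm_f linear_scale orthogonal_transformation_linear)
  have f_0: "f x = 0 \<longleftrightarrow> x = 0" for x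
    by (metis norm_eq_zero norm_f)
  have E': "f -` E \<inter> space sphere_borel \<in> sets sphere_borel"
    using measurable_sets[OF f_meas E] by simp
  define X where "X = {x. x \<noteq> 0 \<and> norm x \<le> 1 \<and> sgn x \<in> E}"
  have "X = sgn -` E \<inter> space (restrict_space lborel (cball 0 1 - {0}))"
    by (auto simp: X_def space_restrict_space)
  then have "X \<in> sets (restrict_space lborel (cball 0 1 - {0}))"
    using measurable_sets[OF measurable_sgn_sphere_borel E] by simp
  then have X: "X \<in> sets borel"
    by (subst (asm) sets_restrict_space_iff) auto
  have "emeasure (distr surface_measure sphere_borel f) E
      = emeasure surface_measure (f -` E \<inter> space sphere_borel)"
    using f_meas E by (subst emeasure_distr)
      (auto simp: space_surface_measure space_sphere_borel measurable_def sets_surface_measure)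
  also have "\<dots> = of_nat DIM('a) * emeasure lborel
      {x. x \<noteq> 0 \<and> norm x \<le> 1 \<and> sgn x \<in> f -` E \<inter> space sphere_borel}"
    by (rule emeasure_surface_measure[OF E'])
  also have "{x. x \<noteq> 0 \<and> norm x \<le> 1 \<and> sgn x \<in> f -` E \<inter> space sphere_borel} = f -` X"
    by (auto simp: X_def norm_f f_sgn f_0 space_sphere_borel norm_sgn)
  also have "emeasure lborel (f -` X) = emeasure (distr lborel borel f) X"
    using measurable_orthogonal_transformation[OF f] X by (subst emeasure_distr) auto
  also have "of_nat DIM('a) * \<dots> = emeasure surface_measure E"
    by (simp add: distr_lborel_orthogonal_transformation[OF f] emeasure_surface_measure[OF E] X_def)
  finally show "emeasure (distr surface_measure sphere_borel f) E = emeasure surface_measure E" .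
qed (simp add: sets_surface_measure)

text \<open>For \<open>c = 0\<close> this is the identity, which makes \<open>reflection_diff\<close> below unconditional.\<close>

definition reflection :: "'a::euclidean_space \<Rightarrow> 'a \<Rightarrow> 'a" where
  "reflection c x = x - (2 * (c \<bullet> x) / (c \<bullet> c)) *\<^sub>R c"

lemma orthogonal_transformation_reflection: "orthogonal_transformation (reflection c)"
proof (cases "c = 0")
  case False
  then have "reflection c v \<bullet> reflection c w = v \<bullet> w" for v w
    by (simp add: reflection_def inner_diff inner_commute)
  moreover have "linear (reflection c)"
    unfolding reflection_def by (intro linearI)
      (auto simp: algebra_simps inner_add add_divide_distrib scaleR_add_left)
  ultimately show ?thesis
    by (simp add: orthogonal_transformation_def)
qed (simp add: reflection_def[abs_def])

lemma inner_reflection: "c \<bullet> reflection c x = - (c \<bullet> x)"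
  by (cases "c = 0") (auto simp: reflection_def inner_diff)

lemma inner_reflection_orthogonal: "b \<bullet> c = 0 \<Longrightarrow> b \<bullet> reflection c x = b \<bullet> x"
  by (simp add: reflection_def inner_diff)

text \<open>Equal norms make the coefficient \<open>2 * (c \<bullet> b) / (c \<bullet> c)\<close>
  equal to 1 for \<open>c = b - e\<close>. This supplies an orthogonal map carrying any unit vector
  to a basis vector.\<close>

lemma reflection_diff:
  assumes "norm b = norm e"
  shows "reflection (b - e) b = e"
proof (cases "b = e")
  case False
  have "b \<bullet> b = e \<bullet> e"
    using assms by (simp add: norm_eq)
  then have "(b - e) \<bullet> (b - e) = 2 * ((b - e) \<bullet> b)"
    by (simp add: inner_diff inner_commute)
  moreover have "(b - e) \<bullet> (b - e) \<noteq> 0"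
    using False by simp
  ultimately show ?thesis
    by (simp add: reflection_def)
qed (simp add: reflection_def)

subsection \<open>The mean absolute coordinate on the sphere\<close>

text \<open>The weight comes from slicing the unit ball: the slice at height \<open>y\<close> has
  radius \<open>sqrt (1 - y\<^sup>2)\<close>, and \<open>n\<close> is its dimension. An
  antiderivative on the right half is \<open>- (sqrt (1 - y\<^sup>2) ^ (n + 2)) / (n + 2)\<close>,
  and the integrand is even.\<close>

lemma nn_integral_abs_times_sqrt_power:
  "(\<integral>\<^sup>+y. ennreal (indicator {-1..1} y * (\<bar>y\<bar> * sqrt (1 - y\<^sup>2) ^ n)) \<partial>lborel) = ennreal (2 / (real n + 2))"
proof -
  have "((\<lambda>y. y * sqrt (1 - y\<^sup>2) ^ n) has_integral
      (- (sqrt (1 - 1\<^sup>2) ^ (n + 2)) / (real n + 2) - (- (sqrt (1 - 0\<^sup>2) ^ (n + 2)) / (real n + 2)))) {0..1}"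
  \<comment> \<open>The chain rule passes through \<open>sqrt\<close>, which is not differentiable
    at 0, the value reached at \<open>y = 1\<close>. Derivatives are therefore taken in the open
    interval only.\<close>
  proof (rule fundamental_theorem_of_calculus_interior)
    fix x :: real
    assume x: "x \<in> {0<..<1}"
    then have *: "0 < 1 - x\<^sup>2"
      by (simp add: power_less_one_iff abs_square_less_1)
    define r where "r = sqrt (1 - x\<^sup>2)"
    have r: "0 < r"
      using * by (simp add: r_def)
    have "((\<lambda>y. sqrt (1 - y\<^sup>2)) has_real_derivative inverse r / 2 * (- (2 * x))) (at x)"
      unfolding r_def
      by (rule DERIV_chain2[where f = sqrt and g = "\<lambda>y. 1 - y\<^sup>2", OF DERIV_real_sqrt[OF *]])
        (auto intro!: derivative_eq_intros)
    from DERIV_cdivide[OF DERIV_minus[OF DERIV_power[OF this, of "n + 2"]], of "real n + 2"]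
    have "((\<lambda>y. - (sqrt (1 - y\<^sup>2) ^ (n + 2)) / (real n + 2)) has_real_derivative
        - (real (n + 2) * (inverse r / 2 * (- (2 * x)) * r ^ (n + 1))) / (real n + 2)) (at x)"
      by (simp add: r_def)
    also have "- (real (n + 2) * (inverse r / 2 * (- (2 * x)) * r ^ (n + 1))) / (real n + 2) = x * r ^ n"
      using r by (simp add: divide_simps)
    finally show "((\<lambda>y. - (sqrt (1 - y\<^sup>2) ^ (n + 2)) / (real n + 2)) has_vector_derivative
        x * sqrt (1 - x\<^sup>2) ^ n) (at x)"
      by (simp add: r_def has_real_derivative_iff_has_vector_derivative)
  qed (auto intro!: continuous_intros)
  then have right: "((\<lambda>y. y * sqrt (1 - y\<^sup>2) ^ n) has_integral 1 / (real n + 2)) {0..1}"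
    by simp
  then have "((\<lambda>y. \<bar>y\<bar> * sqrt (1 - y\<^sup>2) ^ n) has_integral 1 / (real n + 2)) {0..1}"
    by (rule has_integral_eq[rotated]) auto
  moreover from right have "((\<lambda>y. (- y) * sqrt (1 - (- y)\<^sup>2) ^ n) has_integral 1 / (real n + 2)) {-1..-0}"
    by (rule has_integral_reflect_real[where f = "\<lambda>y. y * sqrt (1 - y\<^sup>2) ^ n", THEN iffD2])
  then have "((\<lambda>y. \<bar>y\<bar> * sqrt (1 - y\<^sup>2) ^ n) has_integral 1 / (real n + 2)) {-1..0}"
    unfolding minus_zero by (rule has_integral_eq[rotated]) auto
  ultimately have "((\<lambda>y. \<bar>y\<bar> * sqrt (1 - y\<^sup>2) ^ n) has_integral 1 / (real n + 2) + 1 / (real n + 2)) {-1..1}"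
    by (intro has_integral_combine[of "-1" 0 1]) auto
  then have "((\<lambda>y. if y \<in> {-1..1} then \<bar>y\<bar> * sqrt (1 - y\<^sup>2) ^ n else 0) has_integral 2 / (real n + 2)) UNIV"
    by (subst has_integral_restrict_UNIV) simp
  also have "(\<lambda>y. if y \<in> {-1..1} then \<bar>y\<bar> * sqrt (1 - y\<^sup>2) ^ n else 0)
      = (\<lambda>y. indicator {-1..1} y * (\<bar>y\<bar> * sqrt (1 - y\<^sup>2) ^ n))"
    by (auto simp: fun_eq_iff)
  finally show ?thesis
    by (intro nn_integral_has_integral_lborel) (auto simp: indicator_def abs_square_le_1)
qed

text \<open>Fubini in coordinates: fixing the coordinate along \<open>e\<close> at \<open>y\<close>
  leaves a ball of radius \<open>sqrt (1 - y\<^sup>2)\<close> in one dimension less. What remains is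
  the preceding one-dimensional integral with exponent \<open>DIM('a) - 1\<close>.\<close>

lemma nn_integral_abs_inner_cball:
  fixes e :: "'a::euclidean_space"
  assumes e: "e \<in> Basis"
  shows "(\<integral>\<^sup>+x. ennreal \<bar>e \<bullet> x\<bar> * indicator (cball 0 1) x \<partial>lborel)
    = ennreal (2 * unit_ball_vol (real (DIM('a) - 1)) / (real DIM('a) + 1))"
proof -
  interpret product_sigma_finite "\<lambda>_::'a. lborel :: real measure"
    by standard
  define A where "A = (Basis :: 'a set) - {e}"
  have A: "finite A" "e \<notin> A" "Basis = insert e A" "card A = DIM('a) - 1"
    using e by (auto simp: A_def)
  have e_inner: "e \<bullet> (\<Sum>b\<in>Basis. f b *\<^sub>R b) = f e" for f
    using e by (simp add: inner_sum_right inner_Basis if_distrib cong: if_cong)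
  have norm_sum: "norm (\<Sum>b\<in>Basis. f b *\<^sub>R b :: 'a) = sqrt (\<Sum>b\<in>Basis. (f b)\<^sup>2)" for f
    by (subst norm_eq_sqrt_inner, subst euclidean_inner) (simp add: power2_eq_square)
  define F where "F f = ennreal \<bar>f e\<bar> * indicator {f. sqrt (\<Sum>b\<in>Basis. (f b)\<^sup>2) \<le> 1} f" for f :: "'a \<Rightarrow> real"
  have "(\<integral>\<^sup>+x. ennreal \<bar>e \<bullet> x\<bar> * indicator (cball 0 1) x \<partial>lborel)
      = (\<integral>\<^sup>+f. F f \<partial>Pi\<^sub>M Basis (\<lambda>_. lborel))"
    by (subst lborel_eq, subst nn_integral_distr)
      (auto simp: e_inner norm_sum F_def indicator_def intro!: nn_integral_cong)
  also have "\<dots> = (\<integral>\<^sup>+y. \<integral>\<^sup>+x. F (x(e := y)) \<partial>Pi\<^sub>M A (\<lambda>_. lborel) \<partial>lborel)"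
  proof -
    have "F \<in> borel_measurable (Pi\<^sub>M Basis (\<lambda>_. lborel))"
      unfolding F_def using e by measurable
    then show ?thesis
      unfolding A(3) by (intro product_nn_integral_insert_rev) (use A in auto)
  qed
  \<comment> \<open>The ball condition splits into \<open>\<bar>y\<bar> \<le> 1\<close> and a bound
    on the remaining coordinates, so the inner integrand is a constant times an indicator.\<close>
  also have "\<dots> = (\<integral>\<^sup>+y. \<integral>\<^sup>+x. ennreal (indicator {-1..1} y * \<bar>y\<bar>) *
      indicator ({f. sqrt (\<Sum>b\<in>A. (f b)\<^sup>2) \<le> sqrt (1 - y\<^sup>2)} \<inter> space (Pi\<^sub>M A (\<lambda>_. lborel))) x
      \<partial>Pi\<^sub>M A (\<lambda>_. lborel) \<partial>lborel)"
  proof (intro nn_integral_cong)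
    fix y :: real and x :: "'a \<Rightarrow> real"
    assume x: "x \<in> space (Pi\<^sub>M A (\<lambda>_. lborel))"
    have "(\<Sum>b\<in>A. ((x(e := y)) b)\<^sup>2) = (\<Sum>b\<in>A. (x b)\<^sup>2)"
      using A(2) by (intro sum.cong) auto
    then have sum: "(\<Sum>b\<in>Basis. ((x(e := y)) b)\<^sup>2) = y\<^sup>2 + (\<Sum>b\<in>A. (x b)\<^sup>2)"
      unfolding A(3) using A(1,2) by simp
    have nonneg: "0 \<le> (\<Sum>b\<in>A. (x b)\<^sup>2)"
      by (intro sum_nonneg) simp
    have "y \<in> {-1..1} \<longleftrightarrow> y\<^sup>2 \<le> 1"
      by (auto simp: abs_square_le_1 abs_le_iff)
    moreover have "F (x(e := y)) = ennreal \<bar>y\<bar> * (if y\<^sup>2 + (\<Sum>b\<in>A. (x b)\<^sup>2) \<le> 1 then 1 else 0)"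
      unfolding F_def indicator_def mem_Collect_eq sum by simp
    ultimately show "F (x(e := y)) = ennreal (indicator {-1..1} y * \<bar>y\<bar>) *
        indicator ({f. sqrt (\<Sum>b\<in>A. (f b)\<^sup>2) \<le> sqrt (1 - y\<^sup>2)} \<inter> space (Pi\<^sub>M A (\<lambda>_. lborel))) x"
      using x nonneg by (auto simp: indicator_def)
  qed
  also have "\<dots> = (\<integral>\<^sup>+y. ennreal (indicator {-1..1} y * \<bar>y\<bar>) * emeasure (Pi\<^sub>M A (\<lambda>_. lborel))
      ({f. sqrt (\<Sum>b\<in>A. (f b)\<^sup>2) \<le> sqrt (1 - y\<^sup>2)} \<inter> space (Pi\<^sub>M A (\<lambda>_. lborel))) \<partial>lborel)"
    using A(1) by (intro nn_integral_cong) (subst nn_integral_cmult_indicator, auto)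
  also have "\<dots> = (\<integral>\<^sup>+y. ennreal (unit_ball_vol (real (card A))) *
      ennreal (indicator {-1..1} y * (\<bar>y\<bar> * sqrt (1 - y\<^sup>2) ^ card A)) \<partial>lborel)"
  proof (rule nn_integral_cong_AE)
    \<comment> \<open>The volume formula is applied to balls of positive radius. The slices at
      \<open>-1\<close> and \<open>1\<close> have radius 0, and these two heights form a null
      set.\<close>
    have "AE y in lborel. y \<notin> {-1, 1 :: real}"
      by (intro AE_not_in countable_imp_null_set_lborel) auto
    then show "AE y in lborel. ennreal (indicator {-1..1} y * \<bar>y\<bar>) * emeasure (Pi\<^sub>M A (\<lambda>_. lborel))
        ({f. sqrt (\<Sum>b\<in>A. (f b)\<^sup>2) \<le> sqrt (1 - y\<^sup>2)} \<inter> space (Pi\<^sub>M A (\<lambda>_. lborel)))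
        = ennreal (unit_ball_vol (real (card A))) *
          ennreal (indicator {-1..1} y * (\<bar>y\<bar> * sqrt (1 - y\<^sup>2) ^ card A))"
    proof eventually_elim
      case (elim y)
      show ?case
      proof (cases "y \<in> {-1..1}")
        case True
        then have "\<bar>y\<bar> < 1"
          using elim by auto
        then have "0 < sqrt (1 - y\<^sup>2)"
          by (simp add: abs_square_less_1)
        then show ?thesis
          using True by (subst emeasure_cball_aux[OF A(1)])
            (auto simp: ennreal_mult'[symmetric] mult_ac)
      qed auto
    qed
  qed
  also have "\<dots> = ennreal (unit_ball_vol (real (card A))) * ennreal (2 / (real (card A) + 2))"
    by (subst nn_integral_cmult) (measurable, simp only: nn_integral_abs_times_sqrt_power)
  also have "\<dots> = ennreal (2 * unit_ball_vol (real (DIM('a) - 1)) / (real DIM('a) + 1))"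
    using A(4) by (subst ennreal_mult'[symmetric]) (auto simp: of_nat_diff Suc_leI add.commute mult.commute)
  finally show ?thesis .
qed

section \<open>Radial integration of homogeneous functions and surface integrals\<close>

lemma nn_integral_homogeneous_cball:
  fixes h :: "'a::euclidean_space \<Rightarrow> ennreal"
  assumes h: "h \<in> borel_measurable borel"
    and hom: "\<And>c x. 0 < c \<Longrightarrow> h (c *\<^sub>R x) = h x"
    and t: "0 < t"
  shows "(\<integral>\<^sup>+x. h x * indicator (cball 0 t) x \<partial>lborel)
    = ennreal (t ^ DIM('a)) * (\<integral>\<^sup>+x. h x * indicator (cball 0 1) x \<partial>lborel)"
proof -
  note [measurable] = h
  have [measurable]: "(cball 0 r :: 'a set) \<in> sets borel" for r
    by simp
  \<comment> \<open>Substituting \<open>t *\<^sub>R x\<close> for \<open>x\<close> produces the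
    Jacobian \<open>t ^ DIM('a)\<close>; homogeneity leaves \<open>h\<close> unchanged, and the ball
    of radius \<open>t\<close> becomes the unit ball.\<close>
  have "(\<integral>\<^sup>+x. h x * indicator (cball 0 t) x \<partial>lborel)
      = (\<integral>\<^sup>+x. h x * indicator (cball 0 t) x \<partial>density (distr lborel borel (\<lambda>x. 0 + t *\<^sub>R x)) (\<lambda>_. ennreal (\<bar>t\<bar> ^ DIM('a))))"
    using t lborel_affine[of t "0 :: 'a"] by simp
  also have "\<dots> = (\<integral>\<^sup>+x. ennreal (\<bar>t\<bar> ^ DIM('a)) * (h x * indicator (cball 0 t) x) \<partial>distr lborel borel (\<lambda>x. 0 + t *\<^sub>R x))"
    by (rule nn_integral_density) measurable
  also have "\<dots> = (\<integral>\<^sup>+x. ennreal (\<bar>t\<bar> ^ DIM('a)) * (h (0 + t *\<^sub>R x) * indicator (cball 0 t) (0 + t *\<^sub>R x)) \<partial>lborel)"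
    by (rule nn_integral_distr) measurable
  also have "\<dots> = (\<integral>\<^sup>+x. ennreal (t ^ DIM('a)) * (h x * indicator (cball 0 1) x) \<partial>lborel)"
    using t by (intro nn_integral_cong) (auto simp: hom indicator_def)
  also have "\<dots> = ennreal (t ^ DIM('a)) * (\<integral>\<^sup>+x. h x * indicator (cball 0 1) x \<partial>lborel)"
    by (rule nn_integral_cmult) measurable
  finally show ?thesis .
qed

text \<open>Inserting \<open>1 - norm x = \<integral>\<^sub>0\<^sup>1 [norm x \<le> t] dt\<close> and exchanging the integrals turns the
  difference of the two sides into \<open>\<integral>\<^sub>0\<^sup>1 t ^ d dt = 1 / (d + 1)\<close> times the left integral.\<close>

lemma nn_integral_homogeneous_cball_norm:
  fixes h :: "'a::euclidean_space \<Rightarrow> ennreal"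
  assumes h [measurable]: "h \<in> borel_measurable borel"
    and hom: "\<And>c x. 0 < c \<Longrightarrow> h (c *\<^sub>R x) = h x"
  defines "K \<equiv> \<integral>\<^sup>+x. h x * indicator (cball 0 1) x \<partial>lborel"
  shows "K = (\<integral>\<^sup>+x. h x * ennreal (norm x) * indicator (cball 0 1) x \<partial>lborel)
    + ennreal (1 / (real DIM('a) + 1)) * K"
proof -
  have [measurable]: "(cball 0 1 :: 'a set) \<in> sets borel"
    by simp
  define G where "G x t = h x * indicator {0..1} t * (if norm x \<le> t then 1 else 0)" for x :: 'a and t :: real
  have G_meas: "(\<lambda>(x, t). G x t) \<in> borel_measurable (lborel \<Otimes>\<^sub>M lborel)"
    unfolding G_def case_prod_beta by measurable
  have "(\<integral>\<^sup>+x. h x * ennreal (1 - norm x) * indicator (cball 0 1) x \<partial>lborel)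
      = (\<integral>\<^sup>+x. \<integral>\<^sup>+t. G x t \<partial>lborel \<partial>lborel)"
  proof (rule nn_integral_cong)
    fix x :: 'a
    have "(\<integral>\<^sup>+t. G x t \<partial>lborel) = (\<integral>\<^sup>+t. h x * indicator {norm x..1} t \<partial>lborel)"
      by (intro nn_integral_cong)
        (auto simp: G_def indicator_def intro: order_trans[OF norm_ge_zero])
    also have "\<dots> = h x * emeasure lborel {norm x..1}"
      by (intro nn_integral_cmult_indicator) simp
    finally show "h x * ennreal (1 - norm x) * indicator (cball 0 1) x = (\<integral>\<^sup>+t. G x t \<partial>lborel)"
      by (auto simp: indicator_def)
  qed
  also have "\<dots> = (\<integral>\<^sup>+t. \<integral>\<^sup>+x. G x t \<partial>lborel \<partial>lborel)"
    by (rule lborel_pair.Fubini'[OF G_meas, symmetric])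
  also have "\<dots> = (\<integral>\<^sup>+t. K * ennreal (indicator {0..1} t * t ^ DIM('a)) \<partial>lborel)"
  proof (rule nn_integral_cong_AE)
    \<comment> \<open>The scaling lemma applies to \<open>t > 0\<close>, so the single point 0 is
      discarded.\<close>
    have "AE t in lborel. t \<noteq> (0 :: real)"
      by (rule AE_lborel_singleton)
    then show "AE t in lborel. (\<integral>\<^sup>+x. G x t \<partial>lborel) = K * ennreal (indicator {0..1} t * t ^ DIM('a))"
    proof eventually_elim
      case (elim t)
      show ?case
      proof (cases "t \<in> {0..1}")
        case True
        then have "(\<integral>\<^sup>+x. G x t \<partial>lborel) = (\<integral>\<^sup>+x. h x * indicator (cball 0 t) x \<partial>lborel)"
          by (intro nn_integral_cong) (auto simp: G_def indicator_def)
        then show ?thesis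
          using True elim nn_integral_homogeneous_cball[OF h hom, of t]
          by (simp add: K_def mult.commute)
      qed (simp add: G_def)
    qed
  qed
  also have "\<dots> = K * (\<integral>\<^sup>+t. ennreal (indicator {0..1} t * t ^ DIM('a)) \<partial>lborel)"
    by (intro nn_integral_cmult) simp
  also have "(\<integral>\<^sup>+t. ennreal (indicator {0..1} t * t ^ DIM('a)) \<partial>lborel) = ennreal (1 / (real DIM('a) + 1))"
  proof -
    have "((\<lambda>t. t ^ DIM('a)) has_integral (1 ^ (DIM('a) + 1) / (real DIM('a) + 1) - 0 ^ (DIM('a) + 1) / (real DIM('a) + 1))) {0..1::real}"
    proof (rule fundamental_theorem_of_calculus)
      fix x :: real
      have "((\<lambda>t. t ^ (DIM('a) + 1) / (real DIM('a) + 1)) has_real_derivative x ^ DIM('a)) (at x within {0..1})"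
        using DERIV_cdivide[OF DERIV_pow[of "DIM('a) + 1" x "{0..1}"], of "real DIM('a) + 1"]
        by (simp add: add.commute)
      then show "((\<lambda>t. t ^ (DIM('a) + 1) / (real DIM('a) + 1)) has_vector_derivative x ^ DIM('a)) (at x within {0..1})"
        by (simp add: has_real_derivative_iff_has_vector_derivative)
    qed simp
    then have "((\<lambda>t. if t \<in> {0..1} then t ^ DIM('a) else 0) has_integral 1 / (real DIM('a) + 1)) (UNIV :: real set)"
      by (subst has_integral_restrict_UNIV) simp
    also have "(\<lambda>t. if t \<in> {0..1} then t ^ DIM('a) else 0) = (\<lambda>t. indicator {0..1} t * t ^ DIM('a) :: real)"
      by (auto simp: fun_eq_iff)
    finally show ?thesis
      by (intro nn_integral_has_integral_lborel) (auto simp: indicator_def)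
  qed
  finally have upper: "(\<integral>\<^sup>+x. h x * ennreal (1 - norm x) * indicator (cball 0 1) x \<partial>lborel)
      = ennreal (1 / (real DIM('a) + 1)) * K"
    by (simp add: mult.commute)
  have "K = (\<integral>\<^sup>+x. h x * ennreal (norm x) * indicator (cball 0 1) x
      + h x * ennreal (1 - norm x) * indicator (cball 0 1) x \<partial>lborel)"
    unfolding K_def
  proof (rule nn_integral_cong)
    fix x :: 'a
    have "ennreal (norm x) + ennreal (1 - norm x) = 1" if "norm x \<le> 1"
      using that by (subst ennreal_plus[symmetric]) auto
    then show "h x * indicator (cball 0 1) x = h x * ennreal (norm x) * indicator (cball 0 1) x
        + h x * ennreal (1 - norm x) * indicator (cball 0 1) x"
      by (auto simp: indicator_def distrib_left[symmetric])
  qed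
  also have "\<dots> = (\<integral>\<^sup>+x. h x * ennreal (norm x) * indicator (cball 0 1) x \<partial>lborel)
      + (\<integral>\<^sup>+x. h x * ennreal (1 - norm x) * indicator (cball 0 1) x \<partial>lborel)"
    by (rule nn_integral_add) measurable
  finally show ?thesis
    unfolding upper .
qed

text \<open>This unfolds the cone definition: \<open>sgn\<close> pushes Lebesgue measure on the
  punctured ball to the sphere, and restoring the origin adds only a null set.\<close>

lemma nn_integral_surface_measure:
  fixes f :: "'a::euclidean_space \<Rightarrow> ennreal"
  assumes f: "f \<in> borel_measurable borel"
  shows "(\<integral>\<^sup>+l. f l \<partial>surface_measure)
    = of_nat DIM('a) * (\<integral>\<^sup>+x. f (sgn x) * indicator (cball 0 1) x \<partial>lborel)"
proof -
  have f': "f \<in> borel_measurable sphere_borel"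
    unfolding sphere_borel_def using f by (rule measurable_restrict_space1)
  have "(\<integral>\<^sup>+l. f l \<partial>surface_measure) = of_nat DIM('a) *
      (\<integral>\<^sup>+x. f (sgn x) * indicator (cball 0 1 - {0}) x \<partial>lborel)"
    unfolding surface_measure_def using f'
    by (subst nn_integral_scale_measure, simp, subst nn_integral_distr[OF measurable_sgn_sphere_borel])
      (auto simp: nn_integral_restrict_space)
  also have "(\<integral>\<^sup>+x. f (sgn x) * indicator (cball 0 1 - {0}) x \<partial>lborel)
      = (\<integral>\<^sup>+x. f (sgn x) * indicator (cball 0 1) x \<partial>lborel)"
  proof (rule nn_integral_cong_AE)
    show "AE x in lborel. f (sgn x) * indicator (cball 0 1 - {0}) x = f (sgn x) * indicator (cball 0 1) x"
      using AE_lborel_singleton[of "0 :: 'a"] by eventually_elim (simp add: indicator_def)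
  qed
  finally show ?thesis .
qed

lemma sphere_area_unit_ball_vol:
  assumes "0 < m"
  shows "sphere_area (m - 1) = real m * unit_ball_vol (real m)"
proof -
  have "real m / 2 \<notin> \<int>\<^sub>\<le>\<^sub>0"
    using assms nonpos_Ints_nonpos[of "real m / 2"] by force
  then have "Gamma (real m / 2 + 1) = real m / 2 * Gamma (real m / 2)"
    by (rule Gamma_plus1)
  moreover have "real (m - 1) + 1 = real m"
    using assms by (simp add: of_nat_diff)
  moreover have "Gamma (real m / 2) > 0"
    using assms by (intro Gamma_real_pos) simp
  ultimately show ?thesis
    using assms unfolding unit_ball_vol_def sphere_area_def
    by (simp only:) (simp add: divide_simps)
qed

text \<open>The solid integral of \<open>\<bar>e \<bullet> x\<bar>\<close> is known by slicing, and
  \<open>\<bar>e \<bullet> x\<bar>\<close> is \<open>norm x\<close> times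
  \<open>\<bar>e \<bullet> sgn x\<bar>\<close>, which is homogeneous of degree zero. The radial
  identity thus determines the integral \<open>K\<close> of the latter over the ball, and
  \<open>DIM('a) * K\<close> is the surface integral.\<close>

lemma nn_integral_abs_inner_Basis_sphere:
  fixes e :: "'a::euclidean_space"
  assumes e: "e \<in> Basis"
  shows "(\<integral>\<^sup>+l. ennreal \<bar>e \<bullet> l\<bar> \<partial>surface_measure)
    = ennreal (2 * unit_ball_vol (real (DIM('a) - 1)))"
proof -
  define d where "d = real DIM('a)"
  have d: "0 < d"
    by (simp add: d_def)
  define V where "V = unit_ball_vol (real (DIM('a) - 1))"
  have V: "0 \<le> V"
    by (simp add: V_def)
  define h where "h x = ennreal \<bar>e \<bullet> sgn x\<bar>" for x
  have "(\<lambda>x :: 'a. x /\<^sub>R norm x) \<in> borel_measurable borel"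
    by measurable
  then have "sgn \<in> borel_measurable (borel :: 'a measure)"
    by (simp add: sgn_div_norm[abs_def])
  then have h: "h \<in> borel_measurable borel"
    unfolding h_def by measurable
  define K where "K = (\<integral>\<^sup>+x. h x * indicator (cball 0 1) x \<partial>lborel)"
  have "K = (\<integral>\<^sup>+x. h x * ennreal (norm x) * indicator (cball 0 1) x \<partial>lborel) + ennreal (1 / (d + 1)) * K"
    unfolding K_def d_def by (rule nn_integral_homogeneous_cball_norm[OF h]) (simp add: h_def sgn_scaleR)
  also have "(\<integral>\<^sup>+x. h x * ennreal (norm x) * indicator (cball 0 1) x \<partial>lborel)
      = (\<integral>\<^sup>+x. ennreal \<bar>e \<bullet> x\<bar> * indicator (cball 0 1) x \<partial>lborel)"
  proof (rule nn_integral_cong)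
    fix x :: 'a
    have "\<bar>e \<bullet> sgn x\<bar> * norm x = \<bar>e \<bullet> x\<bar>"
      by (cases "x = 0") (auto simp: sgn_div_norm abs_mult)
    then show "h x * ennreal (norm x) * indicator (cball 0 1) x = ennreal \<bar>e \<bullet> x\<bar> * indicator (cball 0 1) x"
      by (simp add: h_def ennreal_mult'[symmetric])
  qed
  finally have K_eq: "K = ennreal (2 * V / (d + 1)) + ennreal (1 / (d + 1)) * K"
    by (simp add: nn_integral_abs_inner_cball[OF e] d_def V_def)
  \<comment> \<open>The equation \<open>K_eq\<close> is also satisfied by
    \<open>K = \<infinity>\<close>. Comparison with the volume of the ball excludes this, so that it
    can be solved over the reals.\<close>
  have "K \<le> (\<integral>\<^sup>+x. indicator (cball 0 1) x \<partial>(lborel :: 'a measure))"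
    unfolding K_def
  proof (rule nn_integral_mono)
    fix x :: 'a
    have "\<bar>e \<bullet> sgn x\<bar> \<le> norm e * norm (sgn x)"
      by (rule Cauchy_Schwarz_ineq2)
    also have "\<dots> \<le> 1"
      using e by (simp add: norm_sgn)
    finally show "h x * indicator (cball 0 1) x \<le> indicator (cball 0 1) x"
      by (auto simp: h_def indicator_def)
  qed
  also have "\<dots> < \<infinity>"
    by (simp add: emeasure_cball)
  finally obtain k where k: "0 \<le> k" "K = ennreal k"
    by (cases K) auto
  have "ennreal k = ennreal (2 * V / (d + 1) + k / (d + 1))"
    using K_eq k d V by (simp add: ennreal_mult'[symmetric] ennreal_plus[symmetric] del: ennreal_plus)
  then have "k = (2 * V + k) / (d + 1)"
    using k d V by (subst (asm) ennreal_inj) (auto simp: add_divide_distrib)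
  then have "d * k = 2 * V"
    using d by (simp add: field_simps)
  moreover have "(\<integral>\<^sup>+l. ennreal \<bar>e \<bullet> l\<bar> \<partial>surface_measure) = ennreal d * K"
    unfolding K_def h_def d_def ennreal_of_nat_eq_real_of_nat[symmetric]
    by (rule nn_integral_surface_measure) measurable
  ultimately show ?thesis
    using k d by (simp add: ennreal_mult'[symmetric] V_def)
qed

subsection \<open>Sign correlations on the sphere\<close>

lemma finite_measure_surface_measure: "finite_measure surface_measure"
  by (rule finite_measureI) (simp add: space_surface_measure emeasure_surface_measure_sphere)

lemma borel_measurable_surface_measure:
  "f \<in> borel_measurable borel \<Longrightarrow> f \<in> borel_measurable surface_measure"
  unfolding measurable_cong_sets[OF sets_surface_measure refl] sphere_borel_def
  by (rule measurable_restrict_space1)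

lemma integrable_surface_measure_bounded:
  fixes f :: "'a::euclidean_space \<Rightarrow> real"
  assumes "f \<in> borel_measurable borel" "\<And>l. norm l = 1 \<Longrightarrow> \<bar>f l\<bar> \<le> C"
  shows "integrable surface_measure f"
proof (rule finite_measure.integrable_const_bound[OF finite_measure_surface_measure])
  show "AE l in surface_measure. norm (f l) \<le> C"
    using assms(2) by (intro AE_I2) (simp add: space_surface_measure)
  show "f \<in> borel_measurable surface_measure"
    by (rule borel_measurable_surface_measure[OF assms(1)])
qed

lemma integral_surface_measure_orthogonal_transformation:
  fixes f :: "'a::euclidean_space \<Rightarrow> 'a" and g :: "'a \<Rightarrow> real"
  assumes f: "orthogonal_transformation f" and g: "g \<in> borel_measurable borel"
  shows "(LINT l|surface_measure. g (f l)) = (LINT l|surface_measure. g l)"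
proof -
  have f': "f \<in> surface_measure \<rightarrow>\<^sub>M sphere_borel"
    unfolding measurable_cong_sets[OF sets_surface_measure refl]
    by (rule measurable_orthogonal_transformation_sphere[OF f])
  have g': "g \<in> borel_measurable sphere_borel"
    unfolding sphere_borel_def by (rule measurable_restrict_space1[OF g])
  show ?thesis
    using integral_distr[OF f' g'] by (simp add: distr_surface_measure_orthogonal_transformation[OF f])
qed

text \<open>The cone over the great sphere orthogonal to \<open>b\<close> lies in a hyperplane,
  which is Lebesgue null.\<close>

lemma AE_surface_measure_inner_nonzero:
  fixes b :: "'a::euclidean_space"
  assumes "b \<noteq> 0"
  shows "AE l in surface_measure. b \<bullet> l \<noteq> 0"
proof (rule AE_I)
  define E where "E = {l \<in> sphere 0 1. b \<bullet> l = 0}"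
  have H: "{x. b \<bullet> x = 0} \<in> sets borel"
    by (simp add: closed_hyperplane)
  have "E = sphere 0 1 \<inter> {x. b \<bullet> x = 0}"
    by (auto simp: E_def)
  then show E: "E \<in> sets surface_measure"
    unfolding sets_surface_measure sphere_borel_def sets_restrict_space using H by auto
  show "{l \<in> space surface_measure. \<not> b \<bullet> l \<noteq> 0} \<subseteq> E"
    by (auto simp: E_def space_surface_measure)
  have "emeasure lborel {x. b \<bullet> x = 0} = 0"
    using negligible_hyperplane[of b 0] assms H
    by (auto simp: negligible_iff_null_sets null_sets_completion_iff)
  moreover have "emeasure lborel {x. x \<noteq> 0 \<and> norm x \<le> 1 \<and> sgn x \<in> E} \<le> emeasure lborel {x. b \<bullet> x = 0}"
    using H by (intro emeasure_mono) (auto simp: E_def sgn_div_norm)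
  ultimately show "emeasure surface_measure E = 0"
    using E by (simp add: emeasure_surface_measure sets_surface_measure)
qed

text \<open>A reflection carries \<open>b\<close> to a basis vector, and the surface measure is
  invariant under it.\<close>

lemma integral_abs_inner_sphere:
  fixes b :: "'a::euclidean_space"
  assumes b: "norm b = 1"
  shows "(LINT l|surface_measure. \<bar>b \<bullet> l\<bar>) = 2 * unit_ball_vol (real (DIM('a) - 1))"
proof -
  obtain e :: 'a where e: "e \<in> Basis"
    using nonempty_Basis by blast
  define T where "T = reflection (b - e)"
  have T: "orthogonal_transformation T"
    unfolding T_def by (rule orthogonal_transformation_reflection)
  have "T b = e"
    unfolding T_def using b e by (intro reflection_diff) simp
  then have "b \<bullet> l = e \<bullet> T l" for l
    using T by (metis \<open>T b = e\<close> orthogonal_transformation_def)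
  then have "(LINT l|surface_measure. \<bar>b \<bullet> l\<bar>) = (LINT l|surface_measure. \<bar>e \<bullet> T l\<bar>)"
    by simp
  also have "\<dots> = (LINT l|surface_measure. \<bar>e \<bullet> l\<bar>)"
    by (rule integral_surface_measure_orthogonal_transformation[OF T]) measurable
  also have "\<dots> = enn2real (\<integral>\<^sup>+l. ennreal \<bar>e \<bullet> l\<bar> \<partial>surface_measure)"
    by (rule integral_eq_nn_integral) (auto intro: borel_measurable_surface_measure)
  also have "\<dots> = 2 * unit_ball_vol (real (DIM('a) - 1))"
    by (simp add: nn_integral_abs_inner_Basis_sphere[OF e])
  finally show ?thesis .
qed

text \<open>On the sphere in dimension \<open>n + 1\<close> this value is the integral of
  \<open>\<bar>a \<bullet> l\<bar>\<close> for a unit vector \<open>a\<close>, so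
  \<open>biased_density\<close> has total mass 1.\<close>

lemma bias_norm_unit_ball_vol:
  assumes "0 < n"
  shows "bias_norm n = 2 * unit_ball_vol (real n)"
  using assms unfolding bias_norm_def by (subst sphere_area_unit_ball_vol) auto

text \<open>The outputs must be \<open>1\<close> or \<open>-1\<close>, whereas \<open>sgn 0 = 0\<close>.\<close>

definition pm_sign :: "real \<Rightarrow> real" where
  "pm_sign x = (if 0 \<le> x then 1 else -1)"

lemma borel_measurable_sign [measurable]: "pm_sign \<in> borel_measurable borel"
  unfolding pm_sign_def[abs_def] by measurable

lemma abs_mult_sign: "\<bar>x\<bar> * pm_sign x = x" and mult_sign: "x * pm_sign x = \<bar>x\<bar>"
  and abs_sign [simp]: "\<bar>pm_sign x\<bar> = 1" and pm_sign_minus: "x \<noteq> 0 \<Longrightarrow> pm_sign (- x) = - pm_sign x"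
  by (auto simp: pm_sign_def)

lemma inner_sphere_le:
  fixes c l :: "'a::real_inner"
  assumes "norm l = 1"
  shows "\<bar>c \<bullet> l\<bar> \<le> norm c"
  using Cauchy_Schwarz_ineq2[of c l] assms by simp

text \<open>The reflection along \<open>c\<close> fixes \<open>b \<bullet> l\<close> and negates
  \<open>c \<bullet> l\<close>, so the integral equals its own negative.\<close>

lemma integral_inner_sign_orthogonal:
  fixes b c :: "'a::euclidean_space"
  assumes "b \<bullet> c = 0"
  shows "(LINT l|surface_measure. (c \<bullet> l) * pm_sign (b \<bullet> l)) = 0"
proof -
  have "(LINT l|surface_measure. (c \<bullet> l) * pm_sign (b \<bullet> l))
      = (LINT l|surface_measure. (c \<bullet> reflection c l) * pm_sign (b \<bullet> reflection c l))"
    by (rule integral_surface_measure_orthogonal_transformation[OF orthogonal_transformation_reflection, symmetric])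
      measurable
  also have "\<dots> = - (LINT l|surface_measure. (c \<bullet> l) * pm_sign (b \<bullet> l))"
    using assms by (simp add: inner_reflection inner_reflection_orthogonal)
  finally show ?thesis
    by simp
qed

text \<open>Split \<open>a\<close> into its projection on \<open>b\<close> and the orthogonal
  remainder \<open>c\<close>: the projection contributes a multiple of
  \<open>\<bar>b \<bullet> l\<bar>\<close>, and the remainder integrates to 0.\<close>

lemma integral_inner_sign:
  fixes a b :: "'a::euclidean_space"
  assumes b: "norm b = 1"
  shows "(LINT l|surface_measure. (a \<bullet> l) * pm_sign (b \<bullet> l))
    = (a \<bullet> b) * (2 * unit_ball_vol (real (DIM('a) - 1)))"
proof -
  define c where "c = a - (a \<bullet> b) *\<^sub>R b"
  have "b \<bullet> b = 1"
    using b by (simp add: norm_eq_1)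
  then have bc: "b \<bullet> c = 0"
    by (simp add: c_def inner_diff inner_commute)
  have split: "(a \<bullet> l) * pm_sign (b \<bullet> l) = (a \<bullet> b) * \<bar>b \<bullet> l\<bar> + (c \<bullet> l) * pm_sign (b \<bullet> l)" for l
    by (simp add: c_def inner_diff mult_sign[symmetric] algebra_simps)
  have "integrable surface_measure (\<lambda>l. \<bar>b \<bullet> l\<bar>)"
    by (rule integrable_surface_measure_bounded[where C = "norm b"]) (auto simp: inner_sphere_le)
  moreover have "integrable surface_measure (\<lambda>l. (c \<bullet> l) * pm_sign (b \<bullet> l))"
    by (rule integrable_surface_measure_bounded[where C = "norm c"])
      (measurable, simp add: abs_mult inner_sphere_le)
  ultimately show ?thesis
    unfolding split
    by (simp add: integral_abs_inner_sphere[OF b] integral_inner_sign_orthogonal[OF bc])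
qed

lemma integral_inner_sphere:
  "(LINT l|surface_measure. (a :: 'a::euclidean_space) \<bullet> l) = 0"
  \<comment> \<open>For the zero vector the sign is constantly 1, and orthogonality to
    \<open>a\<close> is trivial.\<close>
  using integral_inner_sign_orthogonal[of 0 a] by (simp add: pm_sign_def)

text \<open>The antipodal map preserves \<open>\<bar>a \<bullet> l\<bar>\<close> and flips the sign
  of \<open>b \<bullet> l\<close>. Since \<open>pm_sign 0 = 1\<close>, the flip fails where
  \<open>b \<bullet> l = 0\<close>, which is a null set because \<open>b \<noteq> 0\<close>.\<close>

lemma integral_abs_inner_sign:
  fixes a b :: "'a::euclidean_space"
  assumes "b \<noteq> 0"
  shows "(LINT l|surface_measure. \<bar>a \<bullet> l\<bar> * pm_sign (b \<bullet> l)) = 0"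
proof -
  have neg: "orthogonal_transformation (\<lambda>l :: 'a. - l)"
    by (simp add: orthogonal_transformation_def linear_iff)
  have meas: "(\<lambda>l. \<bar>a \<bullet> l\<bar> * pm_sign (b \<bullet> l)) \<in> borel_measurable borel"
    by measurable
  have "(LINT l|surface_measure. \<bar>a \<bullet> l\<bar> * pm_sign (b \<bullet> l))
      = (LINT l|surface_measure. \<bar>a \<bullet> l\<bar> * pm_sign (- (b \<bullet> l)))"
    using integral_surface_measure_orthogonal_transformation[OF neg meas] by simp
  also have "\<dots> = (LINT l|surface_measure. - (\<bar>a \<bullet> l\<bar> * pm_sign (b \<bullet> l)))"
  proof (rule integral_cong_AE)
    show "AE l in surface_measure. \<bar>a \<bullet> l\<bar> * pm_sign (- (b \<bullet> l)) = - (\<bar>a \<bullet> l\<bar> * pm_sign (b \<bullet> l))"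
      using AE_surface_measure_inner_nonzero[OF assms] by eventually_elim (simp add: pm_sign_minus)
  next
    show "(\<lambda>l. \<bar>a \<bullet> l\<bar> * pm_sign (- (b \<bullet> l))) \<in> borel_measurable surface_measure"
      by (rule borel_measurable_surface_measure) measurable
    show "(\<lambda>l. - (\<bar>a \<bullet> l\<bar> * pm_sign (b \<bullet> l))) \<in> borel_measurable surface_measure"
      by (rule borel_measurable_surface_measure) measurable
  qed
  finally show ?thesis
    by simp
qed

section \<open>Measurability of the outputs and assembly of the simulation\<close>

lemma measurable_sign_inner:
  "(\<lambda>p. pm_sign (fst p \<bullet> snd p)) \<in> (sphere_borel \<Otimes>\<^sub>M sphere_borel :: ('a::euclidean_space \<times> 'a) measure)
    \<rightarrow>\<^sub>M count_space {1, -1}"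
proof -
  \<comment> \<open>The inclusion of the sphere is measurable from the trace sigma-algebra, which
    transfers Borel measurability of the ambient inner product to pairs of points of the
    sphere.\<close>
  have id: "(\<lambda>x. x) \<in> borel_measurable (sphere_borel :: 'a measure)"
    unfolding sphere_borel_def by (rule measurable_restrict_space1) simp
  have [measurable]:
      "fst \<in> borel_measurable (sphere_borel \<Otimes>\<^sub>M sphere_borel :: ('a \<times> 'a) measure)"
      "snd \<in> borel_measurable (sphere_borel \<Otimes>\<^sub>M sphere_borel :: ('a \<times> 'a) measure)"
    by (rule measurable_compose[OF measurable_fst id], rule measurable_compose[OF measurable_snd id])
  show ?thesis
    unfolding pm_sign_def by (rule measurable_If) (simp, simp, measurable)
qed

theorem theorem5:
  fixes n :: nat
  assumes "n \<ge> 1" and "CARD('d::finite) = n + 1"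
  shows "\<exists>A B :: (real ^ 'd) \<times> (real ^ 'd) \<Rightarrow> real.
    A \<in> measurable (sphere_borel \<Otimes>\<^sub>M sphere_borel) (count_space {1, -1}) \<and>
    B \<in> measurable (sphere_borel \<Otimes>\<^sub>M sphere_borel) (count_space {1, -1}) \<and>
    (\<forall>a\<in>sphere 0 1. \<forall>b\<in>sphere 0 1.
      (LINT l|surface_measure. biased_density n a l * A (a, l) * B (b, l)) = a \<bullet> b \<and>
      (LINT l|surface_measure. biased_density n a l * A (a, l)) = 0 \<and>
      (LINT l|surface_measure. biased_density n a l * B (b, l)) = 0)"
proof -
  define S :: "(real ^ 'd) \<times> (real ^ 'd) \<Rightarrow> real" where "S = (\<lambda>p. pm_sign (fst p \<bullet> snd p))"
  \<comment> \<open>The sphere lies in dimension \<open>n + 1\<close>, so the ball in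
    \<open>integral_inner_sign\<close> is \<open>n\<close>-dimensional and the constant there is
    exactly \<open>bias_norm n\<close>.\<close>
  have R: "bias_norm n = 2 * unit_ball_vol (real (DIM(real ^ 'd) - 1))" "bias_norm n > 0"
    using assms by (simp_all add: bias_norm_unit_ball_vol)
  have density_S: "biased_density n a l * S (a, l) = (a \<bullet> l) / bias_norm n" for a l :: "real ^ 'd"
    by (simp add: biased_density_def S_def abs_mult_sign)
  have "(LINT l|surface_measure. biased_density n a l * S (a, l) * S (b, l)) = a \<bullet> b \<and>
      (LINT l|surface_measure. biased_density n a l * S (a, l)) = 0 \<and>
      (LINT l|surface_measure. biased_density n a l * S (b, l)) = 0"
    if "norm b = 1" for a b :: "real ^ 'd"
  proof (intro conjI)
    have "(LINT l|surface_measure. biased_density n a l * S (a, l) * S (b, l))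
        = (LINT l|surface_measure. (a \<bullet> l) * pm_sign (b \<bullet> l) / bias_norm n)"
      unfolding density_S by (simp add: S_def)
    also have "\<dots> = a \<bullet> b"
    proof -
      have "(LINT l|surface_measure. (a \<bullet> l) * pm_sign (b \<bullet> l)) = (a \<bullet> b) * bias_norm n"
        unfolding R(1) by (rule integral_inner_sign[OF that])
      then show ?thesis
        using R(2) by simp
    qed
    finally show "(LINT l|surface_measure. biased_density n a l * S (a, l) * S (b, l)) = a \<bullet> b" .
    show "(LINT l|surface_measure. biased_density n a l * S (a, l)) = 0"
      by (simp add: density_S integral_inner_sphere)
    have "b \<noteq> 0"
      using that by auto
    then show "(LINT l|surface_measure. biased_density n a l * S (b, l)) = 0"
      by (simp add: biased_density_def S_def integral_abs_inner_sign)
  qed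
  then show ?thesis
    using measurable_sign_inner by (intro exI[of _ S]) (auto simp: S_def)
qed

end
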